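(* Let $b_1,\dots,b_m$ be nonzero integers and let $\nabla_m(z)=D_m(b_1,\dots,b_m)(z)$ be the Conway polynomial of the oriented two-bridge link $C(2b_1,-2b_2,\dots,(-1)^{m-1}2b_m)$. Define integers $e_i,d_i$ for $i=0,\dots,m$ by $$e_0=1,\quad d_0=1,\quad e_{i+1}=-(-1)^{b_{i+1}}e_i,\quad d_{i+1}=d_i+e_{i+1}.$$ Then $\nabla_m(z)\equiv f_d(z)\pmod 2$, where $d=|d_m|$ and $f_d$ is the $d$-th Fibonacci polynomial.
   Context: Fibonacci polynomials: $f_0=0$, $f_1=1$, $f_{n+2}(z)=z f_{n+1}(z)+f_n(z)$ for $n\in\mathbf{Z}$. Extended Euler continuant polynomials: for integers $b_1,\dots,b_m$, $D_m(b_1,\dots,b_m)(z)$ is defined by $D_{-1}=0$, $D_0=1$, $D_k=b_k z D_{k-1}+D_{k-2}$; equivalently it is the determinant of the $m\times m$ tridiagonal matrix with diagonal entries $b_1z,\dots,b_mz$, superdiagonal entries $-1$ and subdiagonal entries $1$. For nonzero integers $b_1,\dots,b_m$, $C(2b_1,-2b_2,\dots,(-1)^{m-1}2b_m)$ denotes the two-bridge link in Conway normal form with these numbers of signed crossings in its successive twist regions, oriented so that the two strands of each twist region are antiparallel. It is known (Siebenmann; Cromwell) that its Conway polynomial is $D_m(b_1,\dots,b_m)(z)$. The congruence is coefficientwise in $\mathbf{Z}[z]$. *)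

theory Defs
  imports "HOL-Computational_Algebra.Polynomial" "HOL-Number_Theory.Cong"
begin

text \<open>The variable \<open>z\<close> of \<open>\<int>[z]\<close> is \<open>[:0, 1:]\<close>, so \<open>[:0, c:]\<close> is \<open>c z\<close>.\<close>

fun fib_poly_nat :: "nat \<Rightarrow> int poly" where
  "fib_poly_nat 0 = 0"
| "fib_poly_nat (Suc 0) = 1"
| "fib_poly_nat (Suc (Suc n)) = [:0, 1:] * fib_poly_nat (Suc n) + fib_poly_nat n"

text \<open>The recurrence, run backwards from \<open>f\<^sub>0\<close> and \<open>f\<^sub>1\<close>, gives
  \<open>f\<^bsub>-n\<^esub> = (-1)\<^bsup>n+1\<^esup> f\<^sub>n\<close>; \<open>fib_poly_rec\<close> below confirms it on all of \<open>\<int>\<close>.\<close>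

definition fib_poly :: "int \<Rightarrow> int poly" where
  "fib_poly n = (if n \<ge> 0 then fib_poly_nat (nat n)
                 else (- 1) ^ (nat (- n) + 1) * fib_poly_nat (nat (- n)))"

lemma fib_poly_0: "fib_poly 0 = 0"
  by (simp add: fib_poly_def)

lemma fib_poly_1: "fib_poly 1 = 1"
  by (simp add: fib_poly_def)

lemma fib_poly_rec: "fib_poly (n + 2) = [:0, 1:] * fib_poly (n + 1) + fib_poly n"
proof -
  consider "n \<ge> 0" | "n = -1" | "n \<le> -2" by linarith
  then show ?thesis
  proof cases
    case 1
    then obtain k where "n = int k" using nonneg_int_cases by blast
    moreover have "nat (int k + 2) = Suc (Suc k)" "nat (int k + 1) = Suc k" by auto
    ultimately show ?thesis by (simp add: fib_poly_def)
  next
    case 2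
    then show ?thesis by (simp add: fib_poly_def)
  next
    case 3
    define k where "k = nat (- n - 2)"
    have n: "n = - int k - 2" using 3 by (simp add: k_def)
    have eqs: "nat (- n) = Suc (Suc k)" "nat (- (n + 1)) = Suc k" "nat (- (n + 2)) = k"
      using n by auto
    show ?thesis
    proof (cases "k = 0")
      case True
      then show ?thesis using n by (simp add: fib_poly_def numeral_2_eq_2)
    next
      case False
      then have "\<not> n \<ge> 0" "\<not> n + 1 \<ge> 0" "\<not> n + 2 \<ge> 0" using n by auto
      then show ?thesis
        unfolding fib_poly_def using eqs by (simp add: algebra_simps)
    qed
  qed
qed

text \<open>The extended Euler continuant \<open>D\<^sub>k(b\<^sub>1,\<dots>,b\<^sub>k)\<close>, with \<open>b i\<close> for \<open>b\<^sub>i\<close> (so \<open>b 0\<close> is not used).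
  Since \<open>D\<^bsub>-1\<^esub> = 0\<close> and \<open>D\<^sub>0 = 1\<close>, the recurrence at \<open>k = 1\<close> reads \<open>D\<^sub>1 = b\<^sub>1 z\<close>.
  By Siebenmann and Cromwell, for nonzero \<open>b\<^sub>1,\<dots>,b\<^sub>m\<close> this \<open>D\<^sub>m\<close> is the Conway polynomial of
  the two-bridge link \<open>C(2b\<^sub>1, -2b\<^sub>2, \<dots>, (-1)\<^bsup>m-1\<^esup> 2b\<^sub>m)\<close>, oriented so that the two strands
  of each twist region are antiparallel.\<close>

fun continuant :: "(nat \<Rightarrow> int) \<Rightarrow> nat \<Rightarrow> int poly" where
  "continuant b 0 = 1"
| "continuant b (Suc 0) = [:0, b 1:]"
| "continuant b (Suc (Suc k)) =
     [:0, b (Suc (Suc k)):] * continuant b (Suc k) + continuant b k"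

text \<open>\<open>(-1)\<^bsup>n\<^esup>\<close> for a possibly negative exponent \<open>n\<close>, using \<open>(-1)\<^bsup>-n\<^esup> = (-1)\<^bsup>n\<^esup>\<close>.\<close>

definition minus_one_pow :: "int \<Rightarrow> int" where
  "minus_one_pow n = (- 1) ^ nat \<bar>n\<bar>"

end

theory Submission
  imports Defs
begin

text \<open>Modulo 2 the recurrence \<open>f\<^bsub>n+1\<^esub> = z f\<^sub>n + f\<^bsub>n-1\<^esub>\<close> is invariant under \<open>n \<mapsto> -n\<close>: signs
  disappear, so from two neighbouring Fibonacci polynomials it produces the next one in whichever
  direction it is run (\<open>fib_poly_step_mod_2\<close>), and \<open>f\<^bsub>-n\<^esub> \<equiv> f\<^sub>n\<close>.

  The continuants therefore walk along the two-sided Fibonacci sequence. Suppose that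
  \<open>D\<^sub>k \<equiv> f\<^sub>d\<close> and \<open>D\<^bsub>k-1\<^esub> \<equiv> f\<^bsub>d-e\<^esub>\<close> with \<open>e = \<plusminus>1\<close>, where \<open>e\<close> records the direction of the last
  move. If \<open>b\<^bsub>k+1\<^esub>\<close> is odd, then \<open>D\<^bsub>k+1\<^esub> \<equiv> z f\<^sub>d + f\<^bsub>d-e\<^esub> \<equiv> f\<^bsub>d+e\<^esub>\<close>, a further move in the same
  direction; if it is even, then \<open>D\<^bsub>k+1\<^esub> \<equiv> D\<^bsub>k-1\<^esub> \<equiv> f\<^bsub>d-e\<^esub>\<close>, a move back. This is exactly
  the rule defining \<open>e\<^bsub>k+1\<^esub>\<close> and \<open>d\<^bsub>k+1\<^esub>\<close>. The walk starts with \<open>D\<^sub>0 = f\<^sub>1\<close> and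
  \<open>D\<^bsub>-1\<^esub> = f\<^sub>0\<close>. Congruence of integer polynomials is expressed as divisibility of the
  difference by the constant \<open>[:2:]\<close>.\<close>

lemma two_dvd_fib_poly_abs: "[:2:] dvd fib_poly n - fib_poly \<bar>n\<bar>"
proof (cases "n \<ge> 0")
  case False
  define p where "p = fib_poly_nat (nat (- n))"
  have "fib_poly n = (- 1) ^ (nat (- n) + 1) * p" "fib_poly \<bar>n\<bar> = p"
    using False by (simp_all add: fib_poly_def p_def)
  moreover have "(- 1) ^ (nat (- n) + 1) * p = p \<or> (- 1) ^ (nat (- n) + 1) * p = - p"
    by (cases "even (nat (- n) + 1)") auto
  moreover have "- p - p = [:2:] * (- p)" by (simp add: numeral_poly)
  ultimately show ?thesis by (metis diff_self dvd_0_right dvd_triv_left)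
qed simp

text \<open>For \<open>e = 1\<close> the difference is \<open>0\<close>; for \<open>e = -1\<close> it is \<open>2 z f\<^sub>d\<close>, which is where
  running the recurrence backwards costs a sign.\<close>

lemma fib_poly_step_mod_2:
  assumes "e = 1 \<or> e = - 1"
  shows "[:2:] dvd [:0, 1:] * fib_poly d + fib_poly (d - e) - fib_poly (d + e)"
proof -
  have rec: "fib_poly (d + 1) = [:0, 1:] * fib_poly d + fib_poly (d - 1)"
    using fib_poly_rec[of "d - 1"] by (simp add: algebra_simps)
  from assms show ?thesis
  proof
    assume "e = 1"
    then show ?thesis by (simp add: rec)
  next
    assume "e = - 1"
    then have "[:0, 1:] * fib_poly d + fib_poly (d - e) - fib_poly (d + e)
               = [:2:] * ([:0, 1:] * fib_poly d)"
      by (simp add: rec numeral_poly)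
    then show ?thesis by (metis dvd_triv_left)
  qed
qed

text \<open>The inner \<open>0\<close> is \<open>D\<^bsub>-1\<^esub>\<close>, which makes the recurrence uniform from \<open>D\<^sub>1\<close> on.\<close>

lemma continuant_Suc:
  "continuant b (Suc k) =
     [:0, b (Suc k):] * continuant b k + (case k of 0 \<Rightarrow> 0 | Suc j \<Rightarrow> continuant b j)"
  by (cases k) simp_all

lemma minus_one_pow_eq: "minus_one_pow n = (if even n then 1 else - 1)"
  by (simp add: minus_one_pow_def even_nat_iff)

text \<open>The statement about \<open>D\<^bsub>k-1\<^esub>\<close> supplies the second initial value that each step of the
  walk needs.\<close>

lemma continuant_walk_mod_2:
  fixes b e d :: "nat \<Rightarrow> int"
  assumes "e 0 = 1" and "d 0 = 1"
    and e: "\<And>i. i < m \<Longrightarrow> e (Suc i) = - minus_one_pow (b (Suc i)) * e i"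
    and d: "\<And>i. i < m \<Longrightarrow> d (Suc i) = d i + e (Suc i)"
    and "k \<le> m"
  shows "(e k = 1 \<or> e k = - 1) \<and>
         [:2:] dvd continuant b k - fib_poly (d k) \<and>
         [:2:] dvd (case k of 0 \<Rightarrow> 0 | Suc j \<Rightarrow> continuant b j) - fib_poly (d k - e k)"
  using \<open>k \<le> m\<close>
proof (induction k)
  case 0
  then show ?case using assms(1,2) by (simp add: fib_poly_0 fib_poly_1)
next
  case (Suc k)
  define p where "p = (case k of 0 \<Rightarrow> 0 | Suc j \<Rightarrow> continuant b j)"
  have ek: "e k = 1 \<or> e k = - 1"
    and cur: "[:2:] dvd continuant b k - fib_poly (d k)"
    and prev: "[:2:] dvd p - fib_poly (d k - e k)"
    using Suc by (auto simp: p_def)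
  have eS: "e (Suc k) = (if even (b (Suc k)) then - e k else e k)"
    using e[of k] Suc.prems by (simp add: minus_one_pow_eq)
  have dS: "d (Suc k) = d k + e (Suc k)"
    using d[of k] Suc.prems by simp
  have cS: "continuant b (Suc k) = [:0, b (Suc k):] * continuant b k + p"
    unfolding p_def by (rule continuant_Suc)
  have "[:2:] dvd continuant b (Suc k) - fib_poly (d (Suc k))"
  proof (cases "even (b (Suc k))")
    case True
    then have "[:2:] dvd [:0, b (Suc k):]"
      by (auto simp: const_poly_dvd_iff coeff_pCons split: nat.split)
    then have "[:2:] dvd [:0, b (Suc k):] * continuant b k + (p - fib_poly (d k - e k))"
      using prev by (intro dvd_add dvd_mult2)
    moreover have "continuant b (Suc k) - fib_poly (d (Suc k))
        = [:0, b (Suc k):] * continuant b k + (p - fib_poly (d k - e k))"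
      using True by (simp only: cS dS eS if_True) simp
    ultimately show ?thesis by simp
  next
    case False
    then have "[:2:] dvd [:0, b (Suc k) - 1:]"
      by (auto simp: const_poly_dvd_iff coeff_pCons split: nat.split)
    then have "[:2:] dvd [:0, b (Suc k) - 1:] * continuant b k
        + [:0, 1:] * (continuant b k - fib_poly (d k)) + (p - fib_poly (d k - e k))
        + ([:0, 1:] * fib_poly (d k) + fib_poly (d k - e k) - fib_poly (d k + e k))"
      using cur prev fib_poly_step_mod_2[OF ek] by (intro dvd_add dvd_mult2 dvd_mult)
    moreover have "[:0, b (Suc k):] = [:0, b (Suc k) - 1:] + [:0, 1:]"
      by simp
    then have "continuant b (Suc k) - fib_poly (d (Suc k))
        = [:0, b (Suc k) - 1:] * continuant b k
        + [:0, 1:] * (continuant b k - fib_poly (d k)) + (p - fib_poly (d k - e k))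
        + ([:0, 1:] * fib_poly (d k) + fib_poly (d k - e k) - fib_poly (d k + e k))"
      using False by (simp only: cS dS eS if_False) (simp only: algebra_simps)
    ultimately show ?thesis by simp
  qed
  then show ?case using ek eS dS cur by auto
qed

theorem mainTheorem2:
  fixes m :: nat and b e d :: "nat \<Rightarrow> int"
  assumes "\<forall>i\<in>{1..m}. b i \<noteq> 0"
    and "e 0 = 1" and "d 0 = 1"
    and "\<forall>i<m. e (i + 1) = - minus_one_pow (b (i + 1)) * e i"
    and "\<forall>i<m. d (i + 1) = d i + e (i + 1)"
  shows "\<forall>k. [coeff (continuant b m) k = coeff (fib_poly \<bar>d m\<bar>) k] (mod 2)"
proof -
  have "[:2:] dvd continuant b m - fib_poly (d m)"
    using continuant_walk_mod_2[of e d m b m] assms by simp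
  then have "[:2:] dvd (continuant b m - fib_poly (d m)) + (fib_poly (d m) - fib_poly \<bar>d m\<bar>)"
    by (intro dvd_add two_dvd_fib_poly_abs)
  then show ?thesis
    by (simp add: const_poly_dvd_iff cong_iff_dvd_diff)
qed

end
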